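(* Let $G$ be a finite non-abelian group and let $N\cong\mathbb{Z}_n$ be a cyclic normal Hall subgroup of $G$, of order $n$, which has a complement $H$ in $G$ of prime order $p$ such that $C_N(H)=1$. Then $S(G)=|G|$ if and only if the number of complements of $N$ in $G$ is $n$.
   Context: For a finite group $K$, let $\exp(K)$ denote the exponent of $K$ (the least positive integer $e$ with $a^e=1$ for all $a\in K$), let $o(a)$ denote the order of $a\in K$, and define $\varphi(K)=|\{a\in K \mid o(a)=\exp(K)\}|$. For a finite group $G$, define $S(G)=\sum_{K\leq G}\varphi(K)$, where the sum runs over all subgroups $K$ of $G$ (including the trivial subgroup and $G$ itself). A Hall subgroup is a subgroup whose order is coprime to its index. A complement of $N$ in $G$ is a subgroup $K\leq G$ with $NK=G$ and $N\cap K=1$. $C_N(H)$ is the set of elements of $N$ commuting with every element of $H$. *)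

theory Defs
  imports "HOL-Algebra.Algebra"
begin

definition group_exp :: "('a, 'b) monoid_scheme \<Rightarrow> nat"
  where "group_exp K = (LEAST e. 0 < e \<and> (\<forall>a\<in>carrier K. a [^]\<^bsub>K\<^esub> e = \<one>\<^bsub>K\<^esub>))"

definition phi :: "('a, 'b) monoid_scheme \<Rightarrow> nat"
  where "phi K = card {a \<in> carrier K. group.ord K a = group_exp K}"

definition S :: "('a, 'b) monoid_scheme \<Rightarrow> nat"
  where "S G = (\<Sum>K | subgroup K G. phi (G\<lparr>carrier := K\<rparr>))"

definition hall_subgroup :: "'a set \<Rightarrow> ('a, 'b) monoid_scheme \<Rightarrow> bool"
  where "hall_subgroup N G \<longleftrightarrow> subgroup N G \<and> coprime (card N) (card (rcosets\<^bsub>G\<^esub> N))"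

definition complements :: "('a, 'b) monoid_scheme \<Rightarrow> 'a set \<Rightarrow> 'a set set"
  where "complements G N =
    {K. subgroup K G \<and> N <#>\<^bsub>G\<^esub> K = carrier G \<and> N \<inter> K = {\<one>\<^bsub>G\<^esub>}}"

definition centralizer_in :: "('a, 'b) monoid_scheme \<Rightarrow> 'a set \<Rightarrow> 'a set \<Rightarrow> 'a set"
  where "centralizer_in G N H = {x \<in> N. \<forall>h\<in>H. x \<otimes>\<^bsub>G\<^esub> h = h \<otimes>\<^bsub>G\<^esub> x}"

end

theory Submission
  imports Defs
begin

text \<open>
  Write \<open>\<langle>a\<rangle>\<close> for the cyclic subgroup generated by \<open>a\<close>. If \<open>x\<close> lies outside \<open>N\<close> then \<open>x\<^sup>p\<close> lies
  in the abelian group \<open>N\<close> and commutes with \<open>x\<close>, hence with \<open>H\<close>, so \<open>x\<^sup>p = 1\<close> and \<open>\<langle>x\<rangle>\<close> is a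
  complement of \<open>N\<close>. Consequently the elements outside \<open>N\<close> are partitioned by the nontrivial parts of
  the complements, \<open>np - n = c (p - 1)\<close>, and the number \<open>c\<close> of complements is always \<open>n\<close>. On the
  other hand, a subgroup \<open>K\<close> with an element \<open>a\<close> of order \<open>exp K\<close> must be \<open>\<langle>a\<rangle>\<close>: inside \<open>N\<close> because
  \<open>N\<close> is cyclic, and otherwise because \<open>exp K = p\<close>. So every \<open>a\<close> is counted exactly once in \<open>S(G)\<close>,
  and \<open>S(G) = |G|\<close> always holds as well.
\<close>

section \<open>Element orders, exponents and cyclic subgroups\<close>

lemma (in group) ord_subgroup:
  assumes "subgroup K G" and "a \<in> K"
  shows "group.ord (G\<lparr>carrier := K\<rparr>) a = ord a"
proof -
  interpret K: group "G\<lparr>carrier := K\<rparr>"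
    using assms(1) by (rule subgroup_imp_group)
  have "a \<in> carrier G"
    using assms by (rule subgroup.mem_carrier)
  moreover have "a [^]\<^bsub>G\<lparr>carrier := K\<rparr>\<^esub> k = a [^] k" for k :: nat
    by (rule nat_pow_consistent[symmetric])
  ultimately show ?thesis
    using assms(2) by (simp add: K.ord_unique pow_eq_id)
qed

text \<open>Trades the exponent for divisibility among orders. An order that all others divide is an
  admissible exponent (positive by finiteness), hence at least the least one; conversely every order
  divides the exponent.\<close>

lemma (in group) ord_eq_group_exp_iff:
  assumes "finite (carrier G)" and a: "a \<in> carrier G"
  shows "ord a = group_exp G \<longleftrightarrow> (\<forall>x\<in>carrier G. ord x dvd ord a)"
proof -
  let ?P = "\<lambda>e. 0 < e \<and> (\<forall>x\<in>carrier G. x [^] e = \<one>)"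
  have "?P (order G)"
    using assms(1) by (simp add: order_gt_0_iff_finite pow_order_eq_1)
  then have P: "?P (group_exp G)"
    unfolding group_exp_def by (rule LeastI)
  show ?thesis
  proof
    assume "ord a = group_exp G"
    then show "\<forall>x\<in>carrier G. ord x dvd ord a"
      using P by (simp add: pow_eq_id)
  next
    assume *: "\<forall>x\<in>carrier G. ord x dvd ord a"
    have "?P (ord a)"
      using * ord_ge_1[OF assms] by (auto simp: pow_eq_id)
    then have "group_exp G \<le> ord a"
      unfolding group_exp_def by (rule Least_le)
    moreover have "ord a dvd group_exp G"
      using P a by (simp add: pow_eq_id)
    ultimately show "ord a = group_exp G"
      using P by (simp add: dvd_imp_le le_antisym)
  qed
qed

lemma (in group) phi_subgroup:
  assumes "finite (carrier G)" and K: "subgroup K G"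
  shows "phi (G\<lparr>carrier := K\<rparr>) = card {a \<in> K. \<forall>x\<in>K. ord x dvd ord a}"
proof -
  interpret K: group "G\<lparr>carrier := K\<rparr>"
    using K by (rule subgroup_imp_group)
  have "finite K"
    using assms subgroup.subset finite_subset by blast
  then have "K.ord a = group_exp (G\<lparr>carrier := K\<rparr>) \<longleftrightarrow> (\<forall>x\<in>K. ord x dvd ord a)" if "a \<in> K" for a
    using K.ord_eq_group_exp_iff[of a] that by (simp add: ord_subgroup[OF K])
  then show ?thesis
    unfolding phi_def by (auto intro!: arg_cong[where f = card])
qed

lemma (in group) mem_generate_single:
  "a \<in> generate G {a}"
  by (simp add: generate.incl)

lemma (in group) ord_dvd_ord_if_mem_generate:
  assumes "a \<in> carrier G" and "x \<in> generate G {a}"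
  shows "ord x dvd ord a"
proof -
  obtain k :: int where k: "x = a [^] k"
    using assms generate_pow by auto
  have "x [^] ord a = \<one>"
    unfolding k using assms(1) by (metis int_pow_int int_pow_one int_pow_pow mult.commute pow_ord_eq_1)
  then show ?thesis
    using assms(1) k by (simp add: pow_eq_id)
qed

text \<open>By \<open>gen\<close>, a subgroup is recoverable from any element it counts, so no
  element is counted for two subgroups. Each \<open>a\<close> is counted for
  \<open>generate G {a}\<close>, where all orders divide \<open>ord a\<close>.\<close>

lemma (in group) S_eq_order:
  assumes fin: "finite (carrier G)"
    and gen: "\<And>K a. \<lbrakk>subgroup K G; a \<in> K; \<forall>x\<in>K. ord x dvd ord a\<rbrakk> \<Longrightarrow> K = generate G {a}"
  shows "S G = order G"
proof -
  let ?A = "\<lambda>K. {a \<in> K. \<forall>x\<in>K. ord x dvd ord a}"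
  have finK: "finite K" if "subgroup K G" for K
    using that fin subgroup.subset finite_subset by blast
  have "finite {K. subgroup K G}"
    by (rule finite_subset[of _ "Pow (carrier G)"]) (auto simp: fin subgroup.mem_carrier)
  then have "card (\<Union>K\<in>{K. subgroup K G}. ?A K) = (\<Sum>K | subgroup K G. card (?A K))"
    by (rule card_UN_disjoint) (use finK gen in \<open>simp, blast\<close>)
  moreover have "(\<Union>K\<in>{K. subgroup K G}. ?A K) = carrier G"
  proof
    show "carrier G \<subseteq> (\<Union>K\<in>{K. subgroup K G}. ?A K)"
    proof
      fix a assume a: "a \<in> carrier G"
      then have "subgroup (generate G {a}) G"
        by (simp add: generate_is_subgroup)
      moreover have "a \<in> ?A (generate G {a})"
        using a by (simp add: mem_generate_single ord_dvd_ord_if_mem_generate)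
      ultimately show "a \<in> (\<Union>K\<in>{K. subgroup K G}. ?A K)"
        by blast
    qed
  qed (auto simp: subgroup.mem_carrier)
  ultimately show ?thesis
    by (simp add: S_def phi_subgroup[OF fin] order_def)
qed

text \<open>With \<open>e = ord a\<close>, the elements of a finite cyclic group killed by
  \<open>e\<close> number exactly \<open>e\<close>, so the powers of \<open>a\<close> already
  exhaust them. Since \<open>ord\<close> is 0 on elements of infinite order,
  \<open>ord g \<noteq> 0\<close> says that the group is finite.\<close>

lemma (in group) eq_generate_of_cyclic:
  assumes g: "g \<in> carrier G" "ord g \<noteq> 0"
    and K: "subgroup K G" "K \<subseteq> generate G {g}"
    and a: "a \<in> K" "\<forall>x\<in>K. ord x dvd ord a"
  shows "K = generate G {a}"
proof -
  define e where "e = ord a"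
  have aG: "a \<in> carrier G"
    by (rule subgroup.mem_carrier[OF K(1) a(1)])
  have "e dvd ord g"
    using a(1) K(2) g(1) ord_dvd_ord_if_mem_generate unfolding e_def by blast
  then obtain d where d: "ord g = d * e"
    by (metis dvd_def mult.commute)
  then have d0: "d \<noteq> 0" and e0: "e \<noteq> 0"
    using g(2) by auto
  \<comment> \<open>The subgroup of elements killed by \<open>e\<close>: as
    \<open>ord g = d * e\<close>, the power \<open>g [^] d\<close> has order
    \<open>e\<close>.\<close>
  define L where "L = generate G {g [^] d}"
  have KL: "K \<subseteq> L"
  proof
    fix x assume x: "x \<in> K"
    then obtain k :: nat where k: "x = g [^] k"
      using K(2) g generate_pow_nat by blast
    have "x [^] e = \<one>"
      using a(2) x k g(1) by (simp add: e_def pow_eq_id)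
    \<comment> \<open>Here \<open>x [^] e = \<one>\<close> says that \<open>ord g = d * e\<close>
      divides \<open>k * e\<close>; cancelling \<open>e\<close> turns \<open>x\<close> into a power
      of \<open>g [^] d\<close>.\<close>
    then have "d * e dvd k * e"
      using g(1) by (simp add: k nat_pow_pow pow_eq_id d)
    then obtain j where "k = d * j"
      using e0 by (auto elim: dvdE)
    then have "x = (g [^] d) [^] int j"
      using g(1) by (simp add: k nat_pow_pow int_pow_int)
    then show "x \<in> L"
      unfolding L_def using g(1) generate_pow[of "g [^] d"] by auto
  qed
  have "card L = e"
    unfolding L_def using g(1) d d0 by (simp add: ord_pow flip: generate_pow_card)
  moreover have sub: "generate G {a} \<subseteq> K"
    using a(1) K(1) by (simp add: generate_subgroup_incl)
  moreover have "card (generate G {a}) = e"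
    using aG by (simp add: e_def generate_pow_card)
  moreover have "finite L"
    using \<open>card L = e\<close> e0 by (intro card_ge_0_finite) simp
  \<comment> \<open>\<open>K\<close> is squeezed between \<open>generate G {a}\<close> and
    \<open>L\<close>, which both have \<open>e\<close> elements.\<close>
  ultimately have "generate G {a} = L"
    using KL by (intro card_subset_eq) auto
  then show ?thesis
    using KL sub by blast
qed

section \<open>Products of subgroups, quotients, groups of prime order\<close>

lemma (in group) card_set_mult_disjoint:
  assumes "subgroup A G" and "subgroup B G" and "A \<inter> B = {\<one>}"
  shows "card (A <#> B) = card A * card B"
proof -
  interpret group_disjoint_sum G A B
    by (intro group_disjoint_sum.intro is_group assms)
  have "inj_on (\<lambda>(x, y). x \<otimes> y) (A \<times> B)"
    using cancel assms(3) by (auto simp: inj_on_def)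
  moreover have "A <#> B = (\<lambda>(x, y). x \<otimes> y) ` (A \<times> B)"
    by (auto simp: set_mult_def)
  ultimately show ?thesis
    by (simp add: card_image card_cartesian_product)
qed

text \<open>The index is the order of the quotient group, so this power of the coset of
  \<open>x\<close> is trivial. Later it puts p-th powers into \<open>N\<close>.\<close>

lemma (in normal) pow_card_rcosets_mem:
  assumes "x \<in> carrier G"
  shows "x [^] card (rcosets H) \<in> H"
proof -
  interpret Q: group "G Mod H"
    by (rule factorgroup_is_group)
  interpret h: group_hom G "G Mod H" "\<lambda>a. H #> a"
    by unfold_locales (rule r_coset_hom_Mod)
  have "H #> (x [^] card (rcosets H)) = (H #> x) [^]\<^bsub>G Mod H\<^esub> order (G Mod H)"
    using assms by (simp add: h.hom_nat_pow order_def FactGroup_def)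
  also have "\<dots> = H"
    using assms h.hom_closed by (simp add: Q.pow_order_eq_1)
  finally show ?thesis
    using assms by (metis coset_join1 is_subgroup nat_pow_closed subset)
qed

lemma (in group) generate_eq_of_prime_card:
  assumes K: "subgroup K G" and "Factorial_Ring.prime (card K)"
    and x: "x \<in> K" "x \<noteq> \<one>"
  shows "generate G {x} = K"
proof (rule card_subset_eq)
  have xG: "x \<in> carrier G"
    by (rule subgroup.mem_carrier[OF K x(1)])
  show "finite K"
    using assms(2) by (intro card_ge_0_finite prime_gt_0_nat)
  show "generate G {x} \<subseteq> K"
    using K x by (simp add: generate_subgroup_incl)
  interpret K: group "G\<lparr>carrier := K\<rparr>"
    using K by (rule subgroup_imp_group)
  have "ord x dvd card K"
    using K.ord_dvd_group_order[of x] x by (simp add: ord_subgroup[OF K] order_def)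
  moreover have "ord x \<noteq> 1"
    using x xG ord_eq_1 by blast
  ultimately have "ord x = card K"
    using assms(2) by (metis prime_nat_iff)
  then show "card (generate G {x}) = card K"
    using xG by (simp add: generate_pow_card)
qed

section \<open>Complements of prime order that centralize no nontrivial element of an abelian normal
  Hall subgroup\<close>

locale fixed_point_free_complement = normal N G for N and G (structure) +
  fixes H :: "'a set" and p :: nat
  assumes fin: "finite (carrier G)"
    and compl: "H \<in> complements G N"
    and prime_p: "Factorial_Ring.prime p" and card_H: "card H = p"
    and hall: "hall_subgroup N G"
    and comm_N: "\<lbrakk>x \<in> N; y \<in> N\<rbrakk> \<Longrightarrow> x \<otimes> y = y \<otimes> x"
    and centralizer: "centralizer_in G N H = {\<one>}"
begin

lemma order_eq: "order G = card N * p"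
proof -
  have "subgroup H G" "N <#> H = carrier G" "N \<inter> H = {\<one>}"
    using compl unfolding complements_def by blast+
  then show ?thesis
    using card_set_mult_disjoint[OF subgroup_axioms, of H] card_H by (simp add: order_def)
qed

lemma finite_N: "finite N"
  using subset fin by (rule finite_subset)

lemma card_N_pos: "0 < card N"
proof -
  have "N \<noteq> {}"
    using subgroup.one_closed[OF subgroup_axioms] by blast
  then show ?thesis
    using finite_N by (simp add: card_gt_0_iff)
qed

lemma card_rcosets: "card (rcosets N) = p"
proof -
  have "card (rcosets N) * card N = p * card N"
    using lagrange[OF subgroup_axioms] order_eq by (simp only: mult.commute)
  then show ?thesis
    using card_N_pos by (metis mult_cancel2 less_irrefl)
qed

lemma coprime_p: "coprime (card N) p"
  using hall card_rcosets by (simp add: hall_subgroup_def)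

lemma ord_dvd_card_N:
  assumes "x \<in> N"
  shows "ord x dvd card N"
proof -
  interpret N: group "G\<lparr>carrier := N\<rparr>"
    by (rule subgroup_imp_group[OF subgroup_axioms])
  show ?thesis
    using N.ord_dvd_group_order[of x] assms by (simp add: ord_subgroup[OF subgroup_axioms] order_def)
qed

text \<open>Orders in \<open>N\<close> divide \<open>card N\<close>, which is coprime to
  \<open>p\<close> by the Hall condition.\<close>

lemma one_if_mem_N_ord_dvd:
  assumes "x \<in> N" and "ord x dvd p"
  shows "x = \<one>"
proof -
  have "ord x = 1"
    using assms ord_dvd_card_N coprime_p by (metis coprime_common_divisor_nat)
  then show ?thesis
    using assms(1) mem_carrier ord_eq_1 by blast
qed

lemma pow_p_eq_one:
  assumes x: "x \<in> carrier G" "x \<notin> N"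
  shows "x [^] p = \<one>"
proof -
  have subH: "subgroup H G" and NH: "N <#> H = carrier G"
    using compl by (auto simp: complements_def)
  have "x \<in> N <#> H"
    using x(1) NH by simp
  then obtain m h where m: "m \<in> N" and h: "h \<in> H" and mh: "x = m \<otimes> h"
    by (auto simp: set_mult_def)
  have [simp]: "m \<in> carrier G" "h \<in> carrier G"
    using m h subgroup.mem_carrier[OF subH] mem_carrier by blast+
  define z where "z = x [^] p"
  have zN: "z \<in> N"
    using pow_card_rcosets_mem[OF x(1)] by (simp add: z_def card_rcosets)
  then have [simp]: "z \<in> carrier G"
    by (rule mem_carrier)
  \<comment> \<open>\<open>z\<close> commutes with its root \<open>x = m \<otimes> h\<close>, and
    with \<open>m\<close> because \<open>N\<close> is abelian; cancelling \<open>m\<close> leaves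
    that \<open>z\<close> commutes with \<open>h\<close>.\<close>
  have "z \<otimes> x = x \<otimes> z"
    unfolding z_def using x(1) by (metis nat_pow_Suc nat_pow_Suc2)
  then have "m \<otimes> (z \<otimes> h) = m \<otimes> (h \<otimes> z)"
    using comm_N[OF zN m] by (simp add: mh flip: m_assoc)
  then have zh: "z \<otimes> h = h \<otimes> z"
    by simp
  \<comment> \<open>Otherwise \<open>x = m\<close> would lie in \<open>N\<close>. So
    \<open>h\<close> generates \<open>H\<close>, of prime order, and whatever commutes with
    \<open>h\<close> centralizes \<open>H\<close>.\<close>
  have "h \<noteq> \<one>"
    using x(2) m mh by auto
  then have H: "generate G {h} = H"
    using generate_eq_of_prime_card subH h prime_p card_H by blast
  have "z \<otimes> y = y \<otimes> z" if "y \<in> H" for y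
  proof -
    have "y \<in> {h [^] k |k. k \<in> (UNIV :: nat set)}"
      using that H generate_pow_on_finite_carrier[OF fin, of h] by simp
    then obtain k :: nat where "y = h [^] k"
      by auto
    then show ?thesis
      using group_commutes_pow[of h z k] zh by simp
  qed
  then show ?thesis
    using zN centralizer unfolding centralizer_in_def z_def by blast
qed

lemma ord_eq_p:
  assumes "x \<in> carrier G" "x \<notin> N"
  shows "ord x = p"
proof -
  have "ord x dvd p"
    using assms pow_p_eq_one by (simp add: pow_eq_id)
  moreover have "ord x \<noteq> 1"
    using assms ord_eq_1 by auto
  ultimately show ?thesis
    using prime_p by (metis prime_nat_iff)
qed

text \<open>Coprimality of \<open>card N\<close> and \<open>p\<close> makes the intersection
  trivial; the product then has \<open>card N * p = order G\<close> elements and fills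
  \<open>G\<close>.\<close>

lemma generate_in_complements:
  assumes x: "x \<in> carrier G" "x \<notin> N"
  shows "generate G {x} \<in> complements G N"
proof -
  have sub: "subgroup (generate G {x}) G"
    using x(1) by (simp add: generate_is_subgroup)
  have "N \<inter> generate G {x} \<subseteq> {\<one>}"
    using one_if_mem_N_ord_dvd ord_dvd_ord_if_mem_generate[OF x(1)] ord_eq_p[OF x] by auto
  then have int: "N \<inter> generate G {x} = {\<one>}"
    using generate.one by auto
  have "card (N <#> generate G {x}) = card (carrier G)"
    using card_set_mult_disjoint[OF subgroup_axioms sub int] ord_eq_p[OF x] generate_pow_card[OF x(1)]
      order_eq by (simp add: order_def)
  moreover have "N <#> generate G {x} \<subseteq> carrier G"
    using sub subset subgroup.subset set_mult_closed by blast
  ultimately have "N <#> generate G {x} = carrier G"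
    using fin card_subset_eq by blast
  then show ?thesis
    using sub int by (simp add: complements_def)
qed

lemma card_complement:
  assumes "K \<in> complements G N"
  shows "card K = p"
proof -
  have "subgroup K G" "N <#> K = carrier G" "N \<inter> K = {\<one>}"
    using assms unfolding complements_def by blast+
  then have "card N * card K = card N * p"
    using card_set_mult_disjoint[OF subgroup_axioms, of K] order_eq by (simp add: order_def)
  then show ?thesis
    using card_N_pos by (metis mult_cancel1 less_irrefl)
qed

lemma card_complements: "card (complements G N) = card N"
proof -
  let ?C = "complements G N"
  have subK: "subgroup K G" "N \<inter> K = {\<one>}" if "K \<in> ?C" for K
    using that by (auto simp: complements_def)
  have finC: "finite ?C"
    by (rule finite_subset[of _ "Pow (carrier G)"])
      (auto simp: fin complements_def subgroup.mem_carrier)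
  have finK: "finite K" if "K \<in> ?C" for K
    using subK(1)[OF that] fin subgroup.subset finite_subset by blast
  have gen: "generate G {x} = K" if "K \<in> ?C" "x \<in> K - {\<one>}" for K x
    using generate_eq_of_prime_card[OF subK(1)] that card_complement prime_p by simp
  have "card (\<Union>K\<in>?C. K - {\<one>}) = (\<Sum>K\<in>?C. card (K - {\<one>}))"
  proof (rule card_UN_disjoint[OF finC])
    \<comment> \<open>Complements have prime order, so a nontrivial common element generates
      both.\<close>
    show "\<forall>K\<in>?C. \<forall>L\<in>?C. K \<noteq> L \<longrightarrow> (K - {\<one>}) \<inter> (L - {\<one>}) = {}"
      using gen by blast
  qed (simp add: finK)
  also have "\<dots> = (\<Sum>K\<in>?C. p - 1)"
  proof (rule sum.cong)
    fix K assume K: "K \<in> ?C"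
    then have "\<one> \<in> K"
      using subK(1) subgroup.one_closed by blast
    then show "card (K - {\<one>}) = p - 1"
      using card_complement[OF K] by simp
  qed simp
  also have "(\<Union>K\<in>?C. K - {\<one>}) = carrier G - N"
  proof
    show "(\<Union>K\<in>?C. K - {\<one>}) \<subseteq> carrier G - N"
      using subK subgroup.mem_carrier by fastforce
    show "carrier G - N \<subseteq> (\<Union>K\<in>?C. K - {\<one>})"
    proof
      fix x assume x: "x \<in> carrier G - N"
      then have "x \<in> generate G {x} - {\<one>}"
        using mem_generate_single by auto
      then show "x \<in> (\<Union>K\<in>?C. K - {\<one>})"
        using x generate_in_complements by blast
    qed
  qed
  also have "card (carrier G - N) = card N * (p - 1)"
    using order_eq card_Diff_subset[OF finite_N subset]
    by (simp add: order_def diff_mult_distrib2)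
  \<comment> \<open>As \<open>p > 1\<close>, the factor \<open>p - 1\<close> cancels from both
    counts.\<close>
  finally show ?thesis
    using prime_gt_1_nat[OF prime_p] by simp
qed

text \<open>An element of \<open>K\<close> outside \<open>N\<close> has order \<open>p\<close>, so
  \<open>p\<close> divides \<open>ord a\<close>. Orders in \<open>N\<close> are not divisible by
  \<open>p\<close>, so \<open>a\<close> is outside \<open>N\<close> as well and
  \<open>generate G {a}\<close> complements \<open>N\<close>.\<close>

lemma eq_generate_of_not_subset:
  assumes K: "subgroup K G" "\<not> K \<subseteq> N" and a: "a \<in> K" "\<forall>x\<in>K. ord x dvd ord a"
  shows "K = generate G {a}"
proof
  have carr: "x \<in> carrier G" if "x \<in> K" for x
    by (rule subgroup.mem_carrier[OF K(1) that])
  obtain y where y: "y \<in> K" "y \<notin> N"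
    using K(2) by blast
  have "p dvd ord a"
    using a(2) y(1) ord_eq_p[OF carr[OF y(1)] y(2)] by auto
  moreover have "\<not> p dvd card N"
    using coprime_common_divisor[OF coprime_p, of p] not_prime_unit prime_p by auto
  ultimately have aN: "a \<notin> N"
    using ord_dvd_card_N[of a] dvd_trans by blast
  then have ord_a: "ord a = p"
    using a(1) carr ord_eq_p by blast
  show sub: "generate G {a} \<subseteq> K"
    using a(1) K(1) by (simp add: generate_subgroup_incl)
  show "K \<subseteq> generate G {a}"
  proof
    fix x assume x: "x \<in> K"
    have "generate G {a} \<in> complements G N"
      using a(1) aN carr generate_in_complements by blast
    then have "x \<in> N <#> generate G {a}"
      unfolding complements_def using carr[OF x] by blast
    then obtain m b where m: "m \<in> N" and b: "b \<in> generate G {a}" and mb: "x = m \<otimes> b"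
      by (auto simp: set_mult_def)
    have bK: "b \<in> K"
      using b sub by blast
    \<comment> \<open>The \<open>N\<close>-part of \<open>x\<close> lies in \<open>K\<close>, so its
      order divides \<open>ord a = p\<close>; inside \<open>N\<close> this forces
      \<open>m = \<one>\<close>, and \<open>x = b\<close>.\<close>
    have "m = x \<otimes> inv b"
      using mb m carr[OF bK] mem_carrier by (simp add: m_assoc)
    then have "m \<in> K"
      using x bK K(1) by (simp add: subgroup.m_closed subgroup.m_inv_closed)
    then have "m = \<one>"
      using one_if_mem_N_ord_dvd m a(2) ord_a by metis
    then show "x \<in> generate G {a}"
      using mb b carr[OF bK] by simp
  qed
qed

end

section \<open>Cyclicity of \<open>N\<close> and the conclusion\<close>

lemma cyclic_integer_mod_group: "cyclic_group (integer_mod_group n)"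
proof (rule group.cyclic_group_epimorphic_image[OF group_integer_group _ cyclic_integer_group])
  \<comment> \<open>Reduction modulo \<open>n\<close> maps the integers onto this group; for
    \<open>n = 0\<close> it is the identity on the integers.\<close>
  show "(\<lambda>x. x mod int n) \<in> epi integer_group (integer_mod_group n)"
    unfolding epi_def
  proof (intro CollectI conjI)
    show "(\<lambda>x. x mod int n) \<in> hom integer_group (integer_mod_group n)"
      by (auto simp: hom_def carrier_integer_mod_group mod_simps)
    have "x \<in> range (\<lambda>x. x mod int n)" if "x \<in> carrier (integer_mod_group n)" for x
      using that by (intro image_eqI[of _ _ x]) (auto simp: carrier_integer_mod_group split: if_splits)
    then show "(\<lambda>x. x mod int n) ` carrier integer_group = carrier (integer_mod_group n)"
      by (auto simp: carrier_integer_mod_group)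
  qed
qed simp

lemma (in group) cyclic_subgroup_generator:
  assumes N: "subgroup N G" and "cyclic_group (G\<lparr>carrier := N\<rparr>)"
  obtains g where "g \<in> carrier G" "N = generate G {g}"
proof -
  interpret N: group "G\<lparr>carrier := N\<rparr>"
    using N by (rule subgroup_imp_group)
  obtain g where g: "g \<in> N" "N = range (\<lambda>k::int. g [^]\<^bsub>G\<lparr>carrier := N\<rparr>\<^esub> k)"
    using assms(2) N.cyclic_group by auto
  moreover have gG: "g \<in> carrier G"
    by (rule subgroup.mem_carrier[OF N g(1)])
  ultimately have "N = generate G {g}"
    using int_pow_consistent[OF N g(1)] generate_pow[OF gG] by auto
  with gG show ?thesis
    by (rule that)
qed

theorem theorem8:
  fixes G :: "('a, 'b) monoid_scheme" and N H :: "'a set" and n p :: nat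
  assumes "group G" and "finite (carrier G)" and "\<not> comm_group G"
    and "N \<lhd> G" and "hall_subgroup N G"
    and "G\<lparr>carrier := N\<rparr> \<cong> integer_mod_group n" and "card N = n"
    and "H \<in> complements G N" and "Factorial_Ring.prime p" and "card H = p"
    and "centralizer_in G N H = {\<one>\<^bsub>G\<^esub>}"
  shows "S G = order G \<longleftrightarrow> card (complements G N) = n"
proof -
  interpret group G by fact
  interpret normal N G by fact
  interpret N: group "G\<lparr>carrier := N\<rparr>"
    by (rule subgroup_imp_group[OF subgroup_axioms])
  have cyc: "cyclic_group (G\<lparr>carrier := N\<rparr>)"
    using isomorphic_group_cyclicity[OF assms(6)] cyclic_integer_mod_group N.is_group by simp
  then interpret N: comm_group "G\<lparr>carrier := N\<rparr>"
    by (rule N.cyclic_imp_abelian_group)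
  interpret fixed_point_free_complement N G H p
    using assms(2,5,8-11) N.m_comm by (unfold_locales; simp)
  obtain g where g: "g \<in> carrier G" "N = generate G {g}"
    using cyclic_subgroup_generator[OF subgroup_axioms cyc] .
  have "S G = order G"
  proof (rule S_eq_order[OF fin])
    fix K a assume K: "subgroup K G" "a \<in> K" "\<forall>x\<in>K. ord x dvd ord a"
    show "K = generate G {a}"
    \<comment> \<open>Inside \<open>N\<close> the count in a finite cyclic group applies; otherwise
      the complement generated by \<open>a\<close> does.\<close>
    proof (cases "K \<subseteq> N")
      case True
      moreover have "ord g \<noteq> 0"
        using ord_ge_1[OF fin g(1)] by simp
      ultimately show ?thesis
        using eq_generate_of_cyclic[of g K a] g K by simp
    next
      case False
      then show ?thesis
        using K eq_generate_of_not_subset by blast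
    qed
  qed
  then show ?thesis
    using card_complements assms(7) by simp
qed

end
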